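(* $\displaystyle\liminf_{k\to\infty}\frac{\gamma(k)}{k}\geq\frac12$ and $\displaystyle\limsup_{k\to\infty}\frac{\gamma(k)}{k}\geq 1$.
   Context: The Thue–Morse word is $\mathbf t=\mathbf t_1\mathbf t_2\cdots$ where $\mathbf t_i\in\{0,1\}$ has the parity of the number of $1$'s in the binary expansion of $i-1$. For positive integers $\alpha\le\beta$, $\langle\alpha,\beta\rangle=\mathbf t_\alpha\cdots\mathbf t_\beta$. A $k$-anti-power is a word $w_1\cdots w_k$ with $w_1,\dots,w_k$ pairwise distinct words of equal length. $\mathcal F(k)$ is the set of odd positive integers $m$ such that $\langle 1,km\rangle$ is a $k$-anti-power (this set is nonempty for every $k$). $\gamma(k)=\min\mathcal F(k)$. *)

theory Defs
  imports "HOL-Analysis.Analysis"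
begin

fun bitcount :: "nat \<Rightarrow> nat" where
  "bitcount n = (if n = 0 then 0 else n mod 2 + bitcount (n div 2))"

text \<open>Thue-Morse word, 1-indexed: t_i has the parity of the number of ones
  in the binary expansion of i - 1 (values in {0,1}).\<close>
definition tm :: "nat \<Rightarrow> nat" where
  "tm i = bitcount (i - 1) mod 2"

definition tm_factor :: "nat \<Rightarrow> nat \<Rightarrow> nat list" where
  "tm_factor \<alpha> \<beta> = map tm [\<alpha>..<Suc \<beta>]"

definition anti_power :: "nat \<Rightarrow> 'a list \<Rightarrow> bool" where
  "anti_power k w \<longleftrightarrow> (\<exists>ws. length ws = k \<and> concat ws = w \<and>
      (\<forall>u\<in>set ws. \<forall>v\<in>set ws. length u = length v) \<and> distinct ws)"

definition F_set :: "nat \<Rightarrow> nat set" where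
  "F_set k = {m. odd m \<and> m > 0 \<and> anti_power k (tm_factor 1 (k * m))}"

definition gamma :: "nat \<Rightarrow> nat" where
  "gamma k = (LEAST m. m \<in> F_set k)"

end

theory Submission
  imports Defs
begin

text \<open>
  Write \<open>T n\<close> for the (0-indexed) Thue-Morse letter, and let \<open>m < 2 ^ L\<close> be odd. Blocks number \<open>n\<close>
  and \<open>n + 2 ^ L\<close> of length \<open>m\<close> start at the same offset \<open>r\<close> in the aligned words of length
  \<open>2 ^ L\<close>, with indices \<open>q\<close> and \<open>q + m\<close>. Hence they coincide as soon as \<open>T q = T (q + m)\<close> and either
  \<open>r + m \<le> 2 ^ L\<close> or \<open>T (q + 1) = T (q + 1 + m)\<close>. Some such \<open>n = o(2 ^ L)\<close> exists whenever
  \<open>m + 3 < 2 ^ L\<close>: write \<open>m = 8 * R \<plusminus> c\<close> with \<open>c \<in> {1, 3}\<close>. If the truth value of \<open>T p \<noteq> T (p + R)\<close>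
  differs from that of \<open>c = 3\<close> for some small \<open>p\<close>, a value of \<open>q\<close> close to \<open>8 * p\<close> satisfies both
  equations. Otherwise \<open>p \<mapsto> (T p \<noteq> T (p + R))\<close> is constant on a long interval, which forces \<open>R\<close> to be
  divisible by a high power of 2, and then \<open>n\<close> is explicit.

  Consequently \<open>gamma k + 3 < 2 ^ L\<close> implies \<open>k \<le> (1 + o(1)) * 2 ^ L\<close>. This gives 1/2 in general, and 1
  for \<open>k\<close> just above these bounds. For \<open>m = 2 ^ L - 3\<close> one uses \<open>L + 1\<close>.
\<close>

section \<open>Thue-Morse letters and blocks, indexed from 0\<close>

definition odd_ones :: "nat \<Rightarrow> bool" where
  "odd_ones n \<longleftrightarrow> odd (bitcount n)"

text \<open>Indexing letters and blocks from 0 puts the aligned words of length \<open>2 ^ L\<close>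
  at multiples of \<open>2 ^ L\<close>. No \<open>k\<close> enters, so the same blocks serve every
  anti-power.\<close>

definition tm_block :: "nat \<Rightarrow> nat \<Rightarrow> bool list" where
  "tm_block m n = map (\<lambda>i. odd_ones (n * m + i)) [0..<m]"

declare bitcount.simps [simp del]

lemma odd_ones_0 [simp]: "\<not> odd_ones 0"
  by (simp add: odd_ones_def bitcount.simps)

lemma odd_ones_double [simp]: "odd_ones (2 * n) \<longleftrightarrow> odd_ones n"
  by (cases "n = 0") (simp_all add: odd_ones_def bitcount.simps[of "2 * n"])

lemma odd_ones_Suc_double [simp]: "odd_ones (Suc (2 * n)) \<longleftrightarrow> \<not> odd_ones n"
  by (simp add: odd_ones_def bitcount.simps[of "Suc (2 * n)"])

text \<open>The binary digits of \<open>2 ^ b * x + y\<close> are those of \<open>x\<close> followed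
  by the \<open>b\<close> low digits of \<open>y\<close>, so the digit sums add. Thus the aligned
  word with index \<open>x\<close> is the prefix of length \<open>2 ^ b\<close> or its
  complement.\<close>

lemma odd_ones_power2_mult_add:
  "y < 2 ^ b \<Longrightarrow> odd_ones (2 ^ b * x + y) \<longleftrightarrow> odd_ones x \<noteq> odd_ones y"
proof (induction b arbitrary: y)
  case 0
  then show ?case by simp
next
  case (Suc b)
  obtain z where "y = 2 * z \<or> y = Suc (2 * z)"
    by (metis oddE evenE Suc_eq_plus1)
  then show ?case
  proof
    assume y: "y = 2 * z"
    have "2 ^ Suc b * x + y = 2 * (2 ^ b * x + z)" using y by simp
    then have "odd_ones (2 ^ Suc b * x + y) = odd_ones (2 ^ b * x + z)"
      by (metis odd_ones_double)
    then show ?thesis using Suc y by simp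
  next
    assume y: "y = Suc (2 * z)"
    have "2 ^ Suc b * x + y = Suc (2 * (2 ^ b * x + z))" using y by simp
    then have "odd_ones (2 ^ Suc b * x + y) = (\<not> odd_ones (2 ^ b * x + z))"
      by (metis odd_ones_Suc_double)
    then show ?thesis using Suc y by auto
  qed
qed

lemma odd_ones_numeral:
  "odd_ones 1" "odd_ones (Suc 0)" "odd_ones 2" "\<not> odd_ones 3" "odd_ones 4" "\<not> odd_ones 5"
  by (simp_all add: odd_ones_def bitcount.simps)

lemma odd_ones_mod4:
  "odd_ones (4 * x) \<longleftrightarrow> odd_ones x"
  "odd_ones (4 * x + 1) \<longleftrightarrow> \<not> odd_ones x"
  "odd_ones (4 * x + 2) \<longleftrightarrow> \<not> odd_ones x"
  "odd_ones (4 * x + 3) \<longleftrightarrow> odd_ones x"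
  using odd_ones_power2_mult_add[of 0 2 x] odd_ones_power2_mult_add[of 1 2 x]
    odd_ones_power2_mult_add[of 2 2 x] odd_ones_power2_mult_add[of 3 2 x]
  by (auto simp: odd_ones_numeral)

lemma odd_ones_mod8:
  "odd_ones (8 * x) \<longleftrightarrow> odd_ones x"
  "odd_ones (8 * x + 1) \<longleftrightarrow> \<not> odd_ones x"
  "odd_ones (8 * x + 2) \<longleftrightarrow> \<not> odd_ones x"
  "odd_ones (8 * x + 3) \<longleftrightarrow> odd_ones x"
  "odd_ones (8 * x + 4) \<longleftrightarrow> \<not> odd_ones x"
  "odd_ones (8 * x + 5) \<longleftrightarrow> odd_ones x"
  using odd_ones_power2_mult_add[of 0 3 x] odd_ones_power2_mult_add[of 1 3 x]
    odd_ones_power2_mult_add[of 2 3 x] odd_ones_power2_mult_add[of 3 3 x]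
    odd_ones_power2_mult_add[of 4 3 x] odd_ones_power2_mult_add[of 5 3 x]
  by (auto simp: odd_ones_numeral)

lemma tm_Suc: "tm (Suc n) = of_bool (odd_ones n)"
  by (simp add: tm_def odd_ones_def odd_iff_mod_2_eq_one)

section \<open>Anti-powers as injectivity of the block map\<close>

lemma concat_equal_lengths_nth:
  assumes "\<forall>u\<in>set ws. length u = m" "n < length ws" "i < m"
  shows "concat ws ! (n * m + i) = ws ! n ! i"
  using assms
proof (induction ws arbitrary: n)
  case Nil
  then show ?case by simp
next
  case (Cons u ws)
  then show ?case by (cases n) (auto simp: nth_append)
qed

lemma anti_power_tm_iff:
  assumes "k > 0"
  shows "anti_power k (tm_factor 1 (k * m)) \<longleftrightarrow> inj_on (tm_block m) {..<k}"
proof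
  assume "anti_power k (tm_factor 1 (k * m))"
  then obtain ws where ws: "length ws = k" "concat ws = tm_factor 1 (k * m)"
      "\<forall>u\<in>set ws. \<forall>v\<in>set ws. length u = length v" "distinct ws"
    unfolding anti_power_def by blast
  \<comment> \<open>The definition leaves the common length open; comparing total lengths and
    cancelling \<open>k > 0\<close> forces it to be \<open>m\<close>.\<close>
  have l: "length u = m" if "u \<in> set ws" for u
  proof -
    have "map length ws = replicate k (length u)"
    proof (rule replicate_eqI)
      fix y assume "y \<in> set (map length ws)"
      then obtain v where "v \<in> set ws" "y = length v" by auto
      then show "y = length u" using ws(3) that by metis
    qed (simp add: ws(1))
    then have "k * length u = k * m"
      using arg_cong[OF ws(2), of length]
      by (simp add: length_concat tm_factor_def sum_list_replicate del: upt_Suc)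
    then show ?thesis using assms by simp
  qed
  show "inj_on (tm_block m) {..<k}"
  proof (rule inj_onI)
    fix p q assume pq: "p \<in> {..<k}" "q \<in> {..<k}" "tm_block m p = tm_block m q"
    have val: "ws ! n ! i = of_bool (tm_block m n ! i)" if "n < k" "i < m" for n i
    proof -
      have "n * m + i < Suc n * m" using that by simp
      also have "\<dots> \<le> k * m" using that by (intro mult_right_mono) auto
      finally have "n * m + i < k * m" .
      moreover have "ws ! n ! i = tm_factor 1 (k * m) ! (n * m + i)"
        using concat_equal_lengths_nth[of ws m n i] l ws(1,2) that by simp
      ultimately show ?thesis
        using that by (simp add: tm_factor_def tm_Suc tm_block_def del: upt_Suc)
    qed
    have "ws ! p = ws ! q"
      using val pq l ws(1) by (intro nth_equalityI) auto
    then show "p = q" using pq ws(1,4) by (simp add: nth_eq_iff_index_eq)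
  qed
next
  assume inj: "inj_on (tm_block m) {..<k}"
  define ws :: "nat list list" where "ws = map (\<lambda>n. map of_bool (tm_block m n)) [0..<k]"
  have "concat (map (\<lambda>n. map of_bool (tm_block m n)) [0..<j]) = tm_factor 1 (j * m)" for j
  proof (induction j)
    case 0
    then show ?case by (simp add: tm_factor_def)
  next
    case (Suc j)
    have "[1..<Suc (Suc j * m)] = [1..<Suc (j * m)] @ [Suc (j * m)..<Suc (j * m) + m]"
      using upt_add_eq_append[of 1 "Suc (j * m)" m] by (simp add: algebra_simps del: upt_Suc)
    moreover have "map tm [Suc (j * m)..<Suc (j * m) + m] = map of_bool (tm_block m j)"
      by (rule nth_equalityI) (auto simp: tm_block_def tm_Suc simp del: upt_Suc)
    moreover have "[0..<Suc j] = [0..<j] @ [j]" by simp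
    ultimately show ?case using Suc by (simp add: tm_factor_def del: upt_Suc)
  qed
  then have "concat ws = tm_factor 1 (k * m)" by (simp add: ws_def)
  moreover have "\<forall>u\<in>set ws. length u = m" by (auto simp: ws_def tm_block_def)
  moreover have "inj (map (of_bool :: bool \<Rightarrow> nat))"
    by (rule inj_mapI) (auto simp: inj_def)
  then have "inj_on (\<lambda>n. map (of_bool :: bool \<Rightarrow> nat) (tm_block m n)) {..<k}"
    using inj by (auto simp: inj_on_def)
  then have "distinct ws" by (simp add: ws_def distinct_map atLeast0LessThan)
  moreover have "length ws = k" by (simp add: ws_def)
  ultimately show "anti_power k (tm_factor 1 (k * m))"
    unfolding anti_power_def by metis
qed

section \<open>Constant shift differences and nonemptiness of \<open>F_set k\<close>\<close>

lemma tm_block_eq_iff: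
  "tm_block m p = tm_block m q \<longleftrightarrow> (\<forall>i<m. odd_ones (p * m + i) = odd_ones (q * m + i))"
  by (auto simp: tm_block_def)

text \<open>For even \<open>N\<close>, restricting to even positions halves both \<open>N\<close>
  and the interval. For odd \<open>N\<close> an interval of length at least 4 is impossible: two
  neighbours with different letters, at residues 0, 1 or 2, 3 modulo 4, are shifted to residues 1,
  2, where the letters agree.\<close>

lemma power2_dvd_if_shift_constant:
  assumes "\<And>p. 2 ^ b * y \<le> p \<Longrightarrow> p < 2 ^ b * (y + 1) \<Longrightarrow> (odd_ones p \<noteq> odd_ones (p + N)) = e"
  shows "2 ^ (b - 1) dvd N"
  using assms
proof (induction b arbitrary: N)
  case 0
  then show ?case by simp
next
  case (Suc b)
  show ?case
  proof (cases "b = 0")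
    case True
    then show ?thesis by simp
  next
    case False
    then obtain b' where b': "b = Suc b'" by (cases b) auto
    show ?thesis
    proof (cases "even N")
      case True
      then obtain N' where N': "N = 2 * N'" by blast
      have "(odd_ones p \<noteq> odd_ones (p + N')) = e" if "2 ^ b * y \<le> p" "p < 2 ^ b * (y + 1)" for p
        using Suc.prems[of "2 * p"] that odd_ones_double[of p] odd_ones_double[of "p + N'"] N'
        by simp
      from Suc.IH[OF this] have "2 ^ (b - 1) dvd N'" by blast
      then show ?thesis using N' b' by simp
    next
      case odd: False
      define z where "z = 2 ^ b' * y"
      have D: "(odd_ones (4 * z + i) \<noteq> odd_ones (4 * z + i + N)) = e" if "i < 4" for i
      proof (rule Suc.prems)
        show "2 ^ Suc b * y \<le> 4 * z + i" by (simp add: z_def b')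
        have "(1::nat) \<le> 2 ^ b'" by simp
        with that have "i < 4 * 2 ^ b'" by linarith
        then show "4 * z + i < 2 ^ Suc b * (y + 1)" by (simp add: z_def b' algebra_simps)
      qed
      define R where "R = N div 4"
      have "N mod 4 = 1 \<or> N mod 4 = 3" using odd by presburger
      then have "N = 4 * R + 1 \<or> N = 4 * R + 3" unfolding R_def by presburger
      then show ?thesis
      proof
        assume N: "N = 4 * R + 1"
        have "4 * z + 0 + N = 4 * (z + R) + 1" "4 * z + 1 + N = 4 * (z + R) + 2"
          using N by auto
        then have "odd_ones (4 * z + 0 + N) = odd_ones (4 * z + 1 + N)"
          by (simp only: odd_ones_mod4)
        then show ?thesis using D[of 0] D[of 1] odd_ones_mod4[of z] by auto
      next
        assume N: "N = 4 * R + 3"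
        have "4 * z + 2 + N = 4 * (z + R + 1) + 1" "4 * z + 3 + N = 4 * (z + R + 1) + 2"
          using N by auto
        then have "odd_ones (4 * z + 2 + N) = odd_ones (4 * z + 3 + N)"
          by (simp only: odd_ones_mod4)
        then show ?thesis using D[of 2] D[of 3] odd_ones_mod4[of z] by auto
      qed
    qed
  qed
qed

text \<open>Without a member, the \<open>LEAST\<close> in \<open>gamma\<close> would carry no
  information. For \<open>m = 2 ^ (k + 3) + 1\<close> the offset of block \<open>p\<close> in its
  aligned word drifts by 1 per block, so equal blocks \<open>p < q\<close> give a constant shift
  difference for \<open>q - p\<close>; then \<open>2 ^ k\<close> divides \<open>q - p\<close>, which
  is less than \<open>k\<close>.\<close>

lemma F_set_nonempty: "F_set k \<noteq> {}"
proof (cases "k = 0")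
  case True
  have "1 \<in> F_set 0" by (auto simp: F_set_def anti_power_def tm_factor_def)
  then show ?thesis using True by blast
next
  case False
  define m :: nat where "m = 2 ^ (k + 3) + 1"
  have klt: "k < 2 ^ k" by simp
  have pw: "(2::nat) ^ (k + 1) = 2 * 2 ^ k" "(2::nat) ^ (k + 3) = 8 * 2 ^ k"
    by (simp_all add: power_add)
  have "tm_block m p \<noteq> tm_block m q" if pq: "p < q" "q < k" for p q
  proof
    assume eq: "tm_block m p = tm_block m q"
    \<comment> \<open>Letter \<open>x - p\<close> of block \<open>p\<close> has offset
      \<open>x\<close> in aligned word \<open>p\<close>; the same letter of block \<open>q\<close>
      has offset \<open>x + (q - p)\<close> in aligned word \<open>q\<close>. The dyadic window for
      \<open>x\<close> ensures \<open>p \<le> x\<close> and keeps both offsets below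
      \<open>2 ^ (k + 3)\<close>.\<close>
    have *: "(odd_ones x \<noteq> odd_ones (x + (q - p))) = (odd_ones p \<noteq> odd_ones q)"
      if x: "2 ^ (k + 1) * 1 \<le> x" "x < 2 ^ (k + 1) * (1 + 1)" for x
    proof -
      define i where "i = x - p"
      have i: "i + p = x" using x klt pq unfolding i_def pw by linarith
      have lt': "x + (q - p) < 2 ^ (k + 3)" 
      proof -
        have "x < 4 * 2 ^ k" "q - p < 2 ^ k" using x klt pq by (simp, linarith)
        then show ?thesis unfolding pw by linarith
      qed
      then have lt: "x < 2 ^ (k + 3)" by linarith
      have "p * m + i = 2 ^ (k + 3) * p + x" "q * m + i = 2 ^ (k + 3) * q + (x + (q - p))"
        using i pq by (auto simp: m_def algebra_simps)
      moreover have "odd_ones (p * m + i) = odd_ones (q * m + i)"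
        using eq lt i[symmetric] unfolding tm_block_eq_iff m_def by simp
      ultimately show ?thesis
        using odd_ones_power2_mult_add[OF lt, of p] odd_ones_power2_mult_add[OF lt', of q]
        by auto
    qed
    have "2 ^ (k + 1 - 1) dvd q - p"
      using * by (rule power2_dvd_if_shift_constant[where y = 1])
    then have "2 ^ k dvd q - p" by simp
    then have "2 ^ k \<le> q - p" using pq by (intro dvd_imp_le) auto
    then show False using klt pq by linarith
  qed
  then have "inj_on (tm_block m) {..<k}" by (intro linorder_inj_onI) auto
  then have "m \<in> F_set k" using False anti_power_tm_iff by (simp add: F_set_def m_def)
  then show ?thesis by blast
qed

lemma gamma_props:
  shows "odd (gamma k)" and "k > 0 \<Longrightarrow> inj_on (tm_block (gamma k)) {..<k}"
proof -
  have "gamma k \<in> F_set k"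
    unfolding gamma_def using F_set_nonempty by (metis LeastI_ex ex_in_conv)
  then show "odd (gamma k)" "k > 0 \<Longrightarrow> inj_on (tm_block (gamma k)) {..<k}"
    using anti_power_tm_iff by (auto simp: F_set_def)
qed

section \<open>Criteria for two equal blocks\<close>

lemma inj_on_tm_block_le:
  assumes "inj_on (tm_block m) {..<k}"
  shows "k \<le> 2 ^ m"
proof -
  have "tm_block m ` {..<k} \<subseteq> {xs. set xs \<subseteq> UNIV \<and> length xs = m}"
    by (auto simp: tm_block_def)
  then have "card (tm_block m ` {..<k}) \<le> card {xs :: bool list. set xs \<subseteq> UNIV \<and> length xs = m}"
    by (intro card_mono finite_lists_length_eq) auto
  then show ?thesis
    using card_lists_length_eq[of "UNIV :: bool set" m] assms by (simp add: card_image)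
qed

text \<open>As \<open>m \<le> 2 ^ L\<close>, a block meets only the aligned words \<open>q\<close>
  and \<open>q + 1\<close>, and the second only if \<open>r + m > 2 ^ L\<close>. Its translate by
  \<open>2 ^ L\<close> blocks meets the words \<open>q + m\<close> and \<open>q + 1 + m\<close> at
  the same offsets.\<close>

lemma tm_block_eq_shift:
  assumes nm: "n * m = 2 ^ L * q + r" and "r < 2 ^ L" and "m \<le> 2 ^ L"
    and q: "odd_ones q = odd_ones (q + m)"
    and q1: "r + m \<le> 2 ^ L \<or> odd_ones (q + 1) = odd_ones (q + 1 + m)"
  shows "tm_block m n = tm_block m (n + 2 ^ L)"
  unfolding tm_block_eq_iff
proof (intro allI impI)
  fix i assume i: "i < m"
  have nm': "(n + 2 ^ L) * m = 2 ^ L * (q + m) + r"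
    using nm by (simp add: algebra_simps)
  show "odd_ones (n * m + i) = odd_ones ((n + 2 ^ L) * m + i)"
  proof (cases "r + i < 2 ^ L")
    case True
    then show ?thesis
      using odd_ones_power2_mult_add[OF True, of q] odd_ones_power2_mult_add[OF True, of "q + m"] q
      by (simp add: nm nm' add.assoc)
  next
    case False
    define s where "s = r + i - 2 ^ L"
    have s: "r + i = 2 ^ L + s" "s < 2 ^ L" using False i assms(2,3) by (auto simp: s_def)
    have "n * m + i = 2 ^ L * (q + 1) + s" "(n + 2 ^ L) * m + i = 2 ^ L * (q + 1 + m) + s"
      using s nm nm' by (auto simp: algebra_simps)
    moreover have "odd_ones (q + 1) = odd_ones (q + 1 + m)" using q1 False i by auto
    ultimately show ?thesis 
      using odd_ones_power2_mult_add[OF s(2), of "q + 1"]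
        odd_ones_power2_mult_add[OF s(2), of "q + 1 + m"] by simp
  qed
qed

lemma tm_block_repeat_if_pair:
  assumes m: "m \<le> 2 ^ L" "2 ^ L \<le> 4 * m"
    and "odd_ones q = odd_ones (q + m)" "odd_ones (q + 1) = odd_ones (q + 1 + m)"
  shows "\<exists>n \<le> 4 * q + 1. tm_block m n = tm_block m (n + 2 ^ L)"
proof -
  \<comment> \<open>The first block starting at or after aligned word \<open>q\<close> starts inside
    it, because consecutive starts are \<open>m \<le> 2 ^ L\<close> apart.\<close>
  define n where "n = (LEAST n. 2 ^ L * q \<le> n * m)"
  have "2 ^ L * q \<le> (4 * q) * m" using mult_right_mono[OF m(2), of q] by (simp add: algebra_simps)
  then have n: "2 ^ L * q \<le> n * m" "n \<le> 4 * q"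
    unfolding n_def by (rule LeastI, intro Least_le)
  have "n * m < 2 ^ L * q + 2 ^ L"
  proof (cases n)
    case 0
    then show ?thesis by simp
  next
    case (Suc n')
    then have "n' * m < 2 ^ L * q"
      using not_less_Least[of n' "\<lambda>n. 2 ^ L * q \<le> n * m"] unfolding n_def by simp
    then show ?thesis using Suc m by simp
  qed
  then have "tm_block m n = tm_block m (n + 2 ^ L)"
    using n assms by (intro tm_block_eq_shift[of n m L q "n * m - 2 ^ L * q"]) auto
  then show ?thesis using n by (intro exI[of _ n]) auto
qed

section \<open>Lengths close to a multiple of a high power of 2\<close>

lemma odd_square_mod8:
  fixes u :: nat
  assumes "odd u"
  obtains w where "u * u = 8 * w + 1"
proof -
  obtain j where j: "u = 2 * j + 1" using assms oddE by blast
  have "even (j * (j + 1))" by simp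
  then obtain w where "j * (j + 1) = 2 * w" by blast
  then have "u * u = 8 * w + 1" using j by (simp add: algebra_simps)
  then show ?thesis using that by blast
qed

text \<open>
  The multipliers \<open>s\<close> below make \<open>s * u\<^sup>2\<close> congruent to \<open>s\<close> modulo 8, so that the low three bits
  of \<open>q\<close> are prescribed; the remaining parity is supplied by the assumption on \<open>u\<close>.
\<close>

lemma tm_block_repeat_above_power2_multiple:
  assumes "odd u" and u: "u < 2 ^ a" and av: "2 * a + 5 \<le> v"
    and m: "m = 2 ^ v * u + c"
    and c: "c = 1 \<and> \<not> odd_ones u \<or> c = 3 \<and> odd_ones u"
  shows "\<exists>n \<le> 18 * 2 ^ (2 * a). tm_block m n = tm_block m (n + 2 ^ (a + v))"
proof -
  define A :: nat where "A = 2 ^ a"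
  define V :: nat where "V = 2 ^ v"
  have "(2::nat) ^ (2 * a + 5) \<le> 2 ^ v" using av by (intro power_increasing) auto
  then have AV: "32 * (A * A) \<le> V"
    by (simp add: A_def V_def power_add power_mult power2_eq_square mult.commute power_mult_distrib)
  have A1: "1 \<le> A * A" by (simp add: A_def)
  have uA: "u < A" using u by (simp add: A_def)
  then have uu: "u * u \<le> A * A" "u * A \<le> A * A" by (auto intro: mult_le_mono)
  obtain w where w: "u * u = 8 * w + 1" using odd_square_mod8 assms(1) by blast
  obtain s :: nat where s: "c = 1 \<and> s = 1 \<and> \<not> odd_ones u \<or> c = 3 \<and> s = 2 \<and> odd_ones u"
    using c by blast
  \<comment> \<open>For \<open>n = s * u * A\<close> the product \<open>n * m\<close> equals
    \<open>2 ^ (a + v) * q + r\<close>. The offset \<open>r\<close> is so small that the block stays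
    in one aligned word, and only the letters at \<open>q\<close> and \<open>q + m\<close> have to
    agree.\<close>
  define q where "q = s * (u * u)"
  define r where "r = c * s * (u * A)"
  have r: "r \<le> 6 * (A * A)" using s uu by (auto simp: r_def)
  have "q \<le> 2 * (A * A)" "c \<le> 3" using s uu by (auto simp: q_def)
  then have c3: "c \<le> 3" and qc: "q + c < V" using AV A1 by linarith+
  have "V * (u + 1) \<le> V * A" using uA by (intro mult_le_mono) auto
  then have "V * u + V \<le> A * V" by (simp add: algebra_simps)
  then have "r + (V * u + c) \<le> A * V" using r AV A1 c3 by linarith
  then have rm: "r + m \<le> A * V" by (simp add: m V_def)
  have "odd_ones (q + m) = (odd_ones u \<noteq> odd_ones (q + c))"
    using odd_ones_power2_mult_add[OF qc[unfolded V_def], of u]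
    by (simp add: m algebra_simps)
  moreover have "odd_ones (q + c) = (odd_ones q = (c = 1))"
    using s
  proof
    assume *: "c = 1 \<and> s = 1 \<and> \<not> odd_ones u"
    then have "q = 8 * w + 1" "q + c = 8 * w + 2" by (simp_all add: q_def w)
    then show ?thesis using odd_ones_mod8[of w] * by metis
  next
    assume *: "c = 3 \<and> s = 2 \<and> odd_ones u"
    then have "q = 8 * (2 * w) + 2" "q + c = 8 * (2 * w) + 5" by (simp_all add: q_def w)
    then have "odd_ones q \<noteq> odd_ones (q + c)" by (simp only: odd_ones_mod8) simp
    then show ?thesis using * by auto
  qed
  ultimately have "odd_ones q = odd_ones (q + m)" using s by auto
  moreover have "s * u * A * m = 2 ^ (a + v) * q + r"
    by (simp add: m q_def r_def A_def power_add algebra_simps)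
  moreover have "0 < m" using s m by auto
  ultimately have "tm_block m (s * u * A) = tm_block m (s * u * A + 2 ^ (a + v))"
    using rm by (intro tm_block_eq_shift[of _ _ _ q r]) (auto simp: A_def V_def power_add)
  moreover have "s * u * A \<le> 18 * 2 ^ (2 * a)"
  proof -
    have "s * u * A = s * (u * A)" by simp
    also have "\<dots> \<le> 18 * (A * A)" using s uu by (intro mult_le_mono) auto
    finally show ?thesis by (simp add: A_def power_mult power2_eq_square power_mult_distrib mult.commute)
  qed
  ultimately show ?thesis by blast
qed

text \<open>Block number \<open>s * u * A\<close> now starts \<open>c * s * u * A\<close> places
  before the aligned word \<open>s * u\<^sup>2\<close>. The block before it ends there, hence lies
  in aligned word \<open>s * u\<^sup>2 - 1\<close>; this explains both subtractions of 1.\<close>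

lemma tm_block_repeat_below_power2_multiple:
  assumes "odd u" and u: "u < 2 ^ a" and av: "2 * a + 5 \<le> v"
    and m: "m + c = 2 ^ v * u"
    and c: "c = 1 \<and> \<not> odd_ones u \<or> c = 3 \<and> odd_ones u"
  shows "\<exists>n \<le> 18 * 2 ^ (2 * a). tm_block m n = tm_block m (n + 2 ^ (a + v))"
proof -
  define A :: nat where "A = 2 ^ a"
  define V :: nat where "V = 2 ^ v"
  have "(2::nat) ^ (2 * a + 5) \<le> 2 ^ v" using av by (intro power_increasing) auto
  then have AV: "32 * (A * A) \<le> V"
    by (simp add: A_def V_def power_add power_mult power2_eq_square mult.commute power_mult_distrib)
  have A1: "1 \<le> A * A" by (simp add: A_def)
  have uA: "u < A" using u by (simp add: A_def)
  then have uu: "u * u \<le> A * A" "u * A \<le> A * A" by (auto intro: mult_le_mono)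
  have u0: "u > 0" using assms(1) by (cases u) auto
  obtain w where w: "u * u = 8 * w + 1" using odd_square_mod8 assms(1) by blast
  \<comment> \<open>With these multipliers \<open>q\<close> is 2 or 5 modulo 8 and
    \<open>q - c\<close> is 1 or 2 in the same group of eight, where the letters agree for
    \<open>c = 1\<close> and differ for \<open>c = 3\<close>.\<close>
  obtain s :: nat where s: "c = 1 \<and> s = 3 \<and> \<not> odd_ones u \<or> c = 3 \<and> s = 6 \<and> odd_ones u"
    using c by blast
  define q where "q = s * (u * u) - 1"
  define n where "n = s * (u * A) - 1"
  have "V * (u + 1) \<le> V * A" using uA by (intro mult_le_mono) auto
  then have Vu: "V * u + V \<le> A * V" by (simp add: algebra_simps)
  have csA: "c * s * (u * A) \<le> 18 * (A * A)" using s uu by auto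
  define r where "r = A * V + c - V * u - c * s * (u * A)"
  have r: "r + V * u + c * s * (u * A) = A * V + c"
    using Vu csA AV unfolding r_def by linarith
  have mV: "m + c = V * u" using m by (simp add: V_def)
  have rm: "r + m \<le> A * V" using r mV by linarith
  have V32: "V \<ge> 32" using AV A1 by linarith
  have "V * 1 \<le> V * u" using u0 by (intro mult_le_mono) auto
  then have m0: "m > 0" using mV V32 s by linarith
  have q1: "q + 1 = s * (u * u)" using u0 s by (auto simp: q_def)
  have n1: "n + 1 = s * (u * A)" using u0 s uA by (auto simp: n_def)
  have qV: "q < V" using q1 s uu AV A1 by auto
  have nm: "n * m = 2 ^ (a + v) * q + r"
  proof -
    have eqs: "int n = int s * (int u * int A) - 1" "int q = int s * (int u * int u) - 1"
      "int m = int V * int u - int c"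
      "int r = int A * int V + int c - int V * int u - int c * int s * (int u * int A)"
      using arg_cong[OF n1, of int] arg_cong[OF q1, of int] arg_cong[OF mV, of int]
        arg_cong[OF r, of int] by auto
    have "int n * int m = int A * int V * int q + int r"
      unfolding eqs by (simp add: algebra_simps)
    then have "int (n * m) = int (A * V * q + r)" by simp
    then have "n * m = A * V * q + r" by (simp only: of_nat_eq_iff)
    then show ?thesis by (simp add: A_def V_def power_add)
  qed
  have "q \<ge> c \<and> odd_ones (q - c) = (odd_ones q = (c = 1))"
    using s
  proof
    assume *: "c = 1 \<and> s = 3 \<and> \<not> odd_ones u"
    then have "q = 8 * (3 * w) + 2" "q - c = 8 * (3 * w) + 1" using q1 by (simp_all add: w)
    then show ?thesis using odd_ones_mod8[of "3 * w"] * by simp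
  next
    assume *: "c = 3 \<and> s = 6 \<and> odd_ones u"
    then have q: "q = 8 * (6 * w) + 5" "q - c = 8 * (6 * w) + 2" using q1 by (simp_all add: w)
    then have "odd_ones q \<noteq> odd_ones (q - c)" by (simp only: odd_ones_mod8) simp
    then show ?thesis using * q by auto
  qed
  moreover from this have "q + m = 2 ^ v * u + (q - c)" using mV by (simp add: V_def)
  then have "odd_ones (q + m) = (odd_ones u \<noteq> odd_ones (q - c))"
    using odd_ones_power2_mult_add[of "q - c" v u] qV by (simp add: V_def)
  ultimately have "odd_ones q = odd_ones (q + m)" using s by auto
  then have "tm_block m n = tm_block m (n + 2 ^ (a + v))"
    using rm nm m0 by (intro tm_block_eq_shift[of _ _ _ q r]) (auto simp: A_def V_def power_add)
  moreover have "n \<le> 18 * 2 ^ (2 * a)"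
  proof -
    have "n \<le> s * (u * A)" using n1 by linarith
    also have "\<dots> \<le> 18 * (A * A)" using s uu by (intro mult_le_mono) auto
    finally show ?thesis by (simp add: A_def power_mult power2_eq_square power_mult_distrib mult.commute)
  qed
  ultimately show ?thesis by blast
qed

section \<open>Early repetitions for every odd length and the bound on \<open>k\<close>\<close>

lemma power2_times_odd:
  fixes R :: nat
  assumes "R > 0"
  obtains k u where "R = 2 ^ k * u" "odd u"
  using assms
proof (induction R arbitrary: thesis rule: less_induct)
  case (less R)
  show ?case
  proof (cases "even R")
    case True
    then obtain R' where R': "R = 2 * R'" by blast
    then obtain k u where "R' = 2 ^ k * u" "odd u"
      using less.IH[of R'] less.prems(2) by auto
    then show ?thesis using less.prems(1)[of "Suc k" u] R' by simp
  next
    case False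
    then show ?thesis using less.prems(1)[of 0 R] by simp
  qed
qed

lemma tm_block_repeat:
  assumes "odd m" and mL: "m + 3 < 2 ^ L" and Lm: "2 ^ L \<le> 4 * m"
    and L: "L = a + v" and av: "2 * a + 5 \<le> v"
  shows "\<exists>n \<le> 2 ^ (v + 3). tm_block m n = tm_block m (n + 2 ^ L)"
proof -
  \<comment> \<open>The window \<open>p < 2 ^ b\<close> serves both cases: a good \<open>p\<close>
    gives \<open>n \<le> 4 * q + 1 \<le> 32 * p + 13\<close>, below \<open>2 ^ (v + 3)\<close>, and
    otherwise \<open>2 ^ (b - 1)\<close> divides \<open>R\<close>, so \<open>2 ^ v\<close> divides
    \<open>8 * R\<close>.\<close>
  define b where "b = v - 2"
  have b: "v = b + 2" "b \<ge> 3" using av by (auto simp: b_def)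
  have "\<exists>R. m = 8 * R + 1 \<or> m = 8 * R + 3 \<or> m + 3 = 8 * R \<or> m + 1 = 8 * R"
    using assms(1) by presburger
  then obtain R c where Rc: "m = 8 * R + c \<or> m + c = 8 * R" "c = 1 \<or> c = 3"
    by blast
  show ?thesis
  proof (cases "\<exists>p < 2 ^ b. (odd_ones p \<noteq> odd_ones (p + R)) \<noteq> (c = 3)")
    case True
    then obtain p where p: "p < 2 ^ b" "(odd_ones p \<noteq> odd_ones (p + R)) \<noteq> (c = 3)" by blast
    \<comment> \<open>The positions \<open>q\<close>, \<open>q + 1\<close> are read off from
      \<open>p\<close>, and their shifts by \<open>m\<close> from \<open>p + R\<close>, through
      residues modulo 8. Each \<open>q\<close> is chosen so that both equations reduce to
      \<open>T p \<noteq> T (p + R)\<close> if \<open>c = 1\<close> and to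
      \<open>T p = T (p + R)\<close> if \<open>c = 3\<close>.\<close>
    have "\<exists>q \<le> 8 * p + 3. odd_ones q = odd_ones (q + m) \<and> odd_ones (q + 1) = odd_ones (q + 1 + m)"
    proof -
      consider "m = 8 * R + 1" "c = 1" | "m = 8 * R + 3" "c = 3"
        | "m + 1 = 8 * R" "c = 1" | "m + 3 = 8 * R" "c = 3" using Rc by blast
      then show ?thesis
      proof cases
        case 1
        then have "8 * p + 2 + m = 8 * (p + R) + 3" "8 * p + 2 + 1 + m = 8 * (p + R) + 4"
          "8 * p + 2 + 1 = 8 * p + 3" by auto
        then show ?thesis using p(2) 1
          by (intro exI[of _ "8 * p + 2"]) (simp only: odd_ones_mod8, simp)
      next
        case 2
        then have "8 * p + m = 8 * (p + R) + 3" "8 * p + 1 + m = 8 * (p + R) + 4" by auto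
        then show ?thesis using p(2) 2
          by (intro exI[of _ "8 * p"]) (simp only: odd_ones_mod8, simp)
      next
        case 3
        then have "8 * p + 3 + m = 8 * (p + R) + 2" "8 * p + 3 + 1 + m = 8 * (p + R) + 3"
          "8 * p + 3 + 1 = 8 * p + 4" by auto
        then show ?thesis using p(2) 3
          by (intro exI[of _ "8 * p + 3"]) (simp only: odd_ones_mod8, simp)
      next
        case 4
        then have "8 * p + 3 + m = 8 * (p + R)" "8 * p + 3 + 1 + m = 8 * (p + R) + 1"
          "8 * p + 3 + 1 = 8 * p + 4" by auto
        then show ?thesis using p(2) 4
          by (intro exI[of _ "8 * p + 3"]) (simp only: odd_ones_mod8, simp)
      qed
    qed
    then obtain q where q: "q \<le> 8 * p + 3" "odd_ones q = odd_ones (q + m)"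
      "odd_ones (q + 1) = odd_ones (q + 1 + m)" by blast
    obtain n where n: "n \<le> 4 * q + 1" "tm_block m n = tm_block m (n + 2 ^ L)"
      using tm_block_repeat_if_pair[of m L q] mL Lm q by auto
    have "(2::nat) ^ (v + 3) = 32 * 2 ^ b" using b by (simp add: power_add)
    then have "n \<le> 2 ^ (v + 3)" using n(1) q(1) p(1) by linarith
    then show ?thesis using n by blast
  next
    case False
    then have const: "(odd_ones p \<noteq> odd_ones (p + R)) = (c = 3)" if "p < 2 ^ b" for p
      using that by blast
    have "2 ^ (b - 1) dvd R"
      using const by (intro power2_dvd_if_shift_constant[of b 0 R "c = 3"]) auto
    have "(2::nat) ^ 5 \<le> 2 ^ L" using L av by (intro power_increasing) auto
    then have "R > 0" using Lm Rc by (cases "R = 0") auto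
    then obtain k u where ku: "R = 2 ^ k * u" "odd u" using power2_times_odd by blast
    have u0: "u > 0" using ku(2) by (cases u) auto
    have "b - 1 \<le> k"
    proof (rule ccontr)
      assume "\<not> b - 1 \<le> k"
      then have "(2::nat) ^ Suc k dvd 2 ^ (b - 1)" by (intro le_imp_power_dvd) auto
      then have "2 ^ Suc k dvd R" using \<open>2 ^ (b - 1) dvd R\<close> dvd_trans by blast
      then show False using ku by simp
    qed
    then have kv: "v \<le> k + 3" using b by simp
    have R8: "8 * R = 2 ^ (k + 3) * u" using ku by (simp add: power_add)
    \<comment> \<open>Taking \<open>p = 0\<close> identifies the constant with the letter of
      \<open>R\<close>, hence of \<open>u\<close>; this is the parity condition of the two lemmas on
      multiples of powers of 2.\<close>
    have Tu: "odd_ones u = (c = 3)"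
      using const[of 0] odd_ones_power2_mult_add[of 0 k u] ku by simp
    \<comment> \<open>Here the 3 in \<open>m + 3 < 2 ^ L\<close> matters: \<open>8 * R\<close> may
      exceed \<open>m\<close> by 3 and must still be below \<open>2 ^ L\<close>.\<close>
    have lt: "2 ^ (k + 3) * u < 2 ^ L" using R8 Rc mL by auto
    have "(2::nat) ^ (k + 3) * 1 \<le> 2 ^ (k + 3) * u" using u0 by (intro mult_le_mono) auto
    then have "(2::nat) ^ (k + 3) < 2 ^ L" using lt by linarith
    then have kL: "k + 3 < L" by (rule power_less_imp_less_exp[rotated]) simp
    \<comment> \<open>The exact power of 2 in \<open>8 * R\<close> may exceed \<open>2 ^ v\<close>,
      so \<open>L\<close> is split anew with \<open>k + 3\<close> in place of \<open>v\<close>; this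
      only shrinks \<open>a\<close>.\<close>
    define a' where "a' = L - (k + 3)"
    have a': "a' + (k + 3) = L" "a' \<le> a" using kL kv L by (auto simp: a'_def)
    have "2 ^ (k + 3) * u < 2 ^ (k + 3) * 2 ^ a'"
      using lt a'(1) by (simp flip: power_add add: add.commute)
    then have ua: "u < 2 ^ a'" by simp
    have av': "2 * a' + 5 \<le> k + 3" using a' kv av by linarith
    have c': "c = 1 \<and> \<not> odd_ones u \<or> c = 3 \<and> odd_ones u" using Tu Rc(2) by auto
    have "\<exists>n \<le> 18 * 2 ^ (2 * a'). tm_block m n = tm_block m (n + 2 ^ L)"
      using Rc(1) tm_block_repeat_above_power2_multiple[OF ku(2) ua av' _ c', of m]
        tm_block_repeat_below_power2_multiple[OF ku(2) ua av' _ c', of m]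
      unfolding R8 a'(1) by blast
    then obtain n where n: "n \<le> 18 * 2 ^ (2 * a')" "tm_block m n = tm_block m (n + 2 ^ L)"
      by blast
    have "n \<le> 32 * 2 ^ (2 * a')" using n(1) by linarith
    also have "\<dots> = 2 ^ (2 * a' + 5)" by (simp add: power_add)
    also have "\<dots> \<le> 2 ^ (v + 3)" using a' av by (intro power_increasing) auto
    finally show ?thesis using n by blast
  qed
qed

text \<open>For the least \<open>L'\<close> with \<open>m + 3 < 2 ^ L'\<close>, a repetition at
  distance \<open>2 ^ L'\<close> bounds \<open>k\<close>. The split
  \<open>L' = (a + 3) + (L' - a - 3)\<close> makes it start by block \<open>2 ^ (L' - a)\<close> and
  is admissible exactly when \<open>3 * a + 14 \<le> L'\<close>. For smaller \<open>L'\<close> one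
  has \<open>m \<le> L\<close>, and counting binary words of length \<open>m\<close>
  suffices.\<close>

lemma le_if_gamma_less:
  assumes k: "k > 0" and L: "2 ^ (3 * a + 14) \<le> L" and g: "gamma k + 3 < 2 ^ L"
  shows "k \<le> 2 ^ L + 2 ^ (L - a)"
proof -
  define m where "m = gamma k"
  have inj: "inj_on (tm_block m) {..<k}" and "odd m" using gamma_props k by (auto simp: m_def)
  define L' where "L' = (LEAST L'. m + 3 < 2 ^ L')"
  have L': "m + 3 < 2 ^ L'" "L' \<le> L"
    using g unfolding L'_def m_def by (rule LeastI, intro Least_le)
  show ?thesis
  proof (cases "3 * a + 14 \<le> L'")
    case True
    then have "\<not> m + 3 < 2 ^ (L' - 1)"
      unfolding L'_def by (intro not_less_Least) auto
    then have lo: "2 ^ (L' - 1) \<le> m + 3" by simp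
    have "(2::nat) ^ 13 \<le> 2 ^ (L' - 1)" using True by (intro power_increasing) auto
    then have "m \<ge> 3" using lo by simp
    moreover have "(2::nat) ^ L' = 2 * 2 ^ (L' - 1)" using True by (simp flip: power_Suc)
    ultimately have "2 ^ L' \<le> 4 * m" using lo by linarith
    moreover have "L' = a + 3 + (L' - a - 3)" "2 * (a + 3) + 5 \<le> L' - a - 3"
      "L' - a - 3 + 3 = L' - a" using True by auto
    ultimately obtain n where n: "n \<le> 2 ^ (L' - a)" "tm_block m n = tm_block m (n + 2 ^ L')"
      using tm_block_repeat[OF \<open>odd m\<close> L'(1), of "a + 3" "L' - a - 3"] by auto
    have "\<not> n + 2 ^ L' < k"
    proof
      assume "n + 2 ^ L' < k"
      then have "n = n + 2 ^ L'" using inj n(2) by (intro inj_onD[OF inj]) auto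
      then show False by simp
    qed
    then have "k \<le> 2 ^ L' + 2 ^ (L' - a)" using n(1) by linarith
    also have "\<dots> \<le> 2 ^ L + 2 ^ (L - a)" using L'(2)
      by (intro add_mono power_increasing) auto
    finally show ?thesis .
  next
    case False
    then have "(2::nat) ^ L' \<le> 2 ^ (3 * a + 14)" by (intro power_increasing) auto
    then have "m \<le> L" using L'(1) L by linarith
    then have "(2::nat) ^ m \<le> 2 ^ L" by (intro power_increasing) auto
    then show ?thesis using inj_on_tm_block_le[OF inj] by linarith
  qed
qed

section \<open>From the bound on \<open>k\<close> to the limits of
  \<open>gamma k / k\<close>\<close>

lemma exponent_bounds:
  shows "a + 14 \<le> (2::nat) ^ (3 * a + 14)"
    and "(3::nat) * 2 ^ a \<le> 2 ^ (2 ^ (3 * a + 14))"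
proof -
  have "3 * a + 14 < (2::nat) ^ (3 * a + 14)" by (rule less_exp)
  then show *: "a + 14 \<le> (2::nat) ^ (3 * a + 14)" by linarith
  have "(3::nat) * 2 ^ a \<le> 2 ^ (a + 14)" by (simp add: power_add)
  also have "\<dots> \<le> 2 ^ (2 ^ (3 * a + 14))" using * by (intro power_increasing) auto
  finally show "(3::nat) * 2 ^ a \<le> 2 ^ (2 ^ (3 * a + 14))" .
qed

text \<open>By contraposition of \<open>le_if_gamma_less\<close>,
  \<open>gamma k \<ge> 2 ^ L - 3\<close>; the loss \<open>3 / k\<close> is at most
  \<open>1 / 2 ^ a\<close>. The factor \<open>c\<close> will be close to 2 for the lower limit and
  close to 1 for the upper limit.\<close>

lemma gamma_ratio_ge:
  fixes c :: real
  assumes L: "2 ^ (3 * a + 14) \<le> L" and k: "2 ^ L + 2 ^ (L - a) < k"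
    and c: "c > 0" "real k \<le> c * 2 ^ L"
  shows "real (gamma k) / real k \<ge> 1 / c - 1 / 2 ^ a"
proof -
  have "\<not> gamma k + 3 < 2 ^ L" using le_if_gamma_less[OF _ L, of k] k by auto
  then have "2 ^ L \<le> gamma k + 3" by simp
  then have g: "2 ^ L - 3 \<le> real (gamma k)"
    by (metis of_nat_le_iff of_nat_power of_nat_add of_nat_numeral diff_le_eq)
  have k0: "real k > 0" using k by simp
  have "3 * 2 ^ a \<le> (2::nat) ^ (2 ^ (3 * a + 14))" by (rule exponent_bounds)
  also have "\<dots> \<le> 2 ^ L" using L by (intro power_increasing) auto
  finally have "3 * 2 ^ a \<le> k" using k by linarith
  then have "3 * 2 ^ a \<le> real k"
    by (metis of_nat_le_iff of_nat_power of_nat_mult of_nat_numeral)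
  then have "3 / real k \<le> 1 / 2 ^ a" using k0 by (simp add: field_simps)
  moreover have "1 / c \<le> 2 ^ L / real k" using c k0 by (simp add: field_simps)
  moreover have "(2 ^ L - 3) / real k \<le> real (gamma k) / real k"
    using g k0 by (intro divide_right_mono) auto
  ultimately show ?thesis by (simp add: diff_divide_distrib)
qed

lemma real_power2_diff:
  "a \<le> L \<Longrightarrow> real (2 ^ L + 2 ^ (L - a)) = (1 + 1 / 2 ^ a) * 2 ^ L"
  using power_diff[of "2 :: real" a L] by (simp add: field_simps)

lemma gamma_ratio_eventually_ge:
  "eventually (\<lambda>k. 1 / (2 * (1 + 1 / 2 ^ a)) - 1 / 2 ^ a \<le> real (gamma k) / real k) sequentially"
proof -
  define L0 :: nat where "L0 = 2 ^ (3 * a + 14)"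
  have aL: "a \<le> L0" using exponent_bounds(1)[of a] by (simp add: L0_def)
  show ?thesis
    unfolding eventually_sequentially
  proof (intro exI allI impI)
    fix k :: nat assume k: "2 ^ L0 + 2 ^ (L0 - a) + 1 \<le> k"
    \<comment> \<open>This places \<open>k\<close> between consecutive thresholds
      \<open>2 ^ L + 2 ^ (L - a)\<close>: minimality of \<open>L\<close> gives the lower one, except
      at \<open>L = L0\<close>, where the assumed size of \<open>k\<close> does.\<close>
    define L where "L = (LEAST L. L \<ge> L0 \<and> k \<le> 2 ^ Suc L + 2 ^ (Suc L - a))"
    have "k < 2 ^ k" by (rule less_exp)
    also have "\<dots> \<le> 2 ^ Suc (max k L0)" by (intro power_increasing) auto
    finally have ex: "max k L0 \<ge> L0 \<and> k \<le> 2 ^ Suc (max k L0) + 2 ^ (Suc (max k L0) - a)" by simp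
    have L: "L \<ge> L0" "k \<le> 2 ^ Suc L + 2 ^ (Suc L - a)"
      using LeastI[of "\<lambda>L. L \<ge> L0 \<and> k \<le> 2 ^ Suc L + 2 ^ (Suc L - a)", OF ex]
      unfolding L_def by auto
    have lo: "2 ^ L + 2 ^ (L - a) < k"
    proof (cases "L = L0")
      case True
      then show ?thesis using k by simp
    next
      case False
      then obtain L1 where L1: "L = Suc L1" "L1 \<ge> L0" using L(1) by (cases L) auto
      then have "\<not> (L1 \<ge> L0 \<and> k \<le> 2 ^ Suc L1 + 2 ^ (Suc L1 - a))"
        using not_less_Least[of L1 "\<lambda>L. L \<ge> L0 \<and> k \<le> 2 ^ Suc L + 2 ^ (Suc L - a)"]
        unfolding L_def by auto
      then show ?thesis using L1 by auto
    qed
    have "real k \<le> real (2 ^ Suc L + 2 ^ (Suc L - a))" using L(2) by (simp only: of_nat_le_iff)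
    also have "\<dots> = (1 + 1 / 2 ^ a) * 2 ^ Suc L" using aL L(1) by (intro real_power2_diff) auto
    finally have "real k \<le> (2 * (1 + 1 / 2 ^ a)) * 2 ^ L" by (simp add: algebra_simps)
    then show "1 / (2 * (1 + 1 / 2 ^ a)) - 1 / 2 ^ a \<le> real (gamma k) / real k"
      using L(1) lo by (intro gamma_ratio_ge[of a L]) (auto simp: L0_def add_pos_pos)
  qed
qed

lemma gamma_ratio_frequently_ge:
  "\<exists>k\<ge>K. 1 / (1 + 2 / 2 ^ a) - 1 / 2 ^ a \<le> real (gamma k) / real k"
proof -
  define L :: nat where "L = max K (2 ^ (3 * a + 14))"
  have L: "L \<ge> K" "2 ^ (3 * a + 14) \<le> L" by (auto simp: L_def)
  have aL: "a \<le> L" using exponent_bounds(1)[of a] L(2) by linarith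
  \<comment> \<open>The first integer past a threshold; the extra 1 is at most
    \<open>2 ^ (L - a)\<close>, whence \<open>2 / 2 ^ a\<close> in the bound.\<close>
  define k :: nat where "k = 2 ^ L + 2 ^ (L - a) + 1"
  have "L < 2 ^ L" by (rule less_exp)
  then have "k \<ge> K" using L(1) unfolding k_def by linarith
  have "real k = (1 + 1 / 2 ^ a) * 2 ^ L + 1"
    using real_power2_diff[OF aL] unfolding k_def by simp
  moreover have "(2::real) ^ a \<le> 2 ^ L" using aL by (intro power_increasing) auto
  then have "1 \<le> 1 / 2 ^ a * (2::real) ^ L" by (simp add: field_simps)
  ultimately have "real k \<le> (1 + 1 / 2 ^ a) * 2 ^ L + 1 / 2 ^ a * 2 ^ L" by linarith
  then have "real k \<le> (1 + 2 / 2 ^ a) * 2 ^ L" by (simp add: algebra_simps)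
  then have "1 / (1 + 2 / 2 ^ a) - 1 / 2 ^ a \<le> real (gamma k) / real k"
    using L(2) by (intro gamma_ratio_ge[of a L]) (auto simp: k_def add_pos_pos)
  then show ?thesis using \<open>k \<ge> K\<close> by blast
qed

theorem theorem3:
  shows "liminf (\<lambda>k. ereal (real (gamma k) / real k)) \<ge> 1/2 \<and>
         limsup (\<lambda>k. ereal (real (gamma k) / real k)) \<ge> 1"
proof
  \<comment> \<open>Each bound holds for a fixed \<open>a\<close>; letting \<open>a\<close> tend to
    infinity afterwards yields the limits 1/2 and 1.\<close>
  have inv: "(\<lambda>a. 1 / 2 ^ a :: real) \<longlonglongrightarrow> 0"
    using LIMSEQ_realpow_zero[of "1 / 2 :: real"] by (simp add: power_one_over)
  have "(\<lambda>a. 1 / (2 * (1 + 1 / 2 ^ a)) - 1 / 2 ^ a :: real) \<longlonglongrightarrow> 1 / (2 * (1 + 0)) - 0"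
    by (intro tendsto_intros inv) auto
  then have "(\<lambda>a. ereal (1 / (2 * (1 + 1 / 2 ^ a)) - 1 / 2 ^ a)) \<longlonglongrightarrow> ereal (1 / 2)"
    by simp
  moreover have "ereal (1 / (2 * (1 + 1 / 2 ^ a)) - 1 / 2 ^ a)
      \<le> liminf (\<lambda>k. ereal (real (gamma k) / real k))" for a
    using gamma_ratio_eventually_ge[of a] by (intro Liminf_bounded) simp
  ultimately have "ereal (1 / 2) \<le> liminf (\<lambda>k. ereal (real (gamma k) / real k))"
    by (rule LIMSEQ_le_const2[OF _ exI, rule_format])
  moreover have "(1 / 2 :: ereal) = ereal (1 / 2)"
    by (simp add: one_ereal_def)
  ultimately show "liminf (\<lambda>k. ereal (real (gamma k) / real k)) \<ge> 1/2"
    by simp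
  have "(\<lambda>a. 1 / (1 + 2 * (1 / 2 ^ a)) - 1 / 2 ^ a :: real) \<longlonglongrightarrow> 1 / (1 + 2 * 0) - 0"
    by (intro tendsto_intros inv) auto
  then have "(\<lambda>a. ereal (1 / (1 + 2 / 2 ^ a) - 1 / 2 ^ a)) \<longlonglongrightarrow> ereal 1"
    by simp
  moreover have "ereal (1 / (1 + 2 / 2 ^ a) - 1 / 2 ^ a)
      \<le> limsup (\<lambda>k. ereal (real (gamma k) / real k))" for a
    unfolding limsup_INF_SUP
  proof (rule INF_greatest)
    fix K :: nat
    obtain k where "k \<ge> K" "1 / (1 + 2 / 2 ^ a) - 1 / 2 ^ a \<le> real (gamma k) / real k"
      using gamma_ratio_frequently_ge by blast
    then show "ereal (1 / (1 + 2 / 2 ^ a) - 1 / 2 ^ a)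
        \<le> (SUP k\<in>{K..}. ereal (real (gamma k) / real k))"
      by (intro SUP_upper2[of k]) auto
  qed
  ultimately have "ereal 1 \<le> limsup (\<lambda>k. ereal (real (gamma k) / real k))"
    by (rule LIMSEQ_le_const2[OF _ exI, rule_format])
  then show "limsup (\<lambda>k. ereal (real (gamma k) / real k)) \<ge> 1"
    by (simp add: one_ereal_def)
qed

end
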